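(* Let $c>1$ be a real number which is not an integer, let $\|c\|$ denote the distance from $c$ to the nearest integer, and put $\beta = 2^{c+2}(c+2)^2/\|c\|$. Let $H$ be a positive integer. Then there exists $R_0$ (depending on $c$ and $H$) such that for every integer $R\ge R_0$ and every integer $r$, there exists a positive integer $m\le R^{\beta}$ such that $$\lfloor (m+h)^c\rfloor \equiv r+h \pmod R \quad\text{for all integers } h\in[1,H].$$
   Context: $\lfloor u\rfloor$ is the integer part of $u$; $\|u\|=\min(\{u\},1-\{u\})$ where $\{u\}=u-\lfloor u\rfloor$. *)

theory Defs
  imports "HOL-Analysis.Analysis" "HOL-Number_Theory.Cong"
begin

definition dist_nearest_int :: "real \<Rightarrow> real" where
  "dist_nearest_int u = min (frac u) (1 - frac u)"

end

theory Submission
  imports Defs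
begin

text \<open>
  Put \<open>g n = n\<^sup>c / R\<close> and \<open>k = \<lfloor>c\<rfloor>\<close>. Modulo 1, each forward difference \<open>\<Delta>\<^sup>j g\<close> moves by
  steps \<open>\<Delta>\<^sup>j\<^sup>+\<^sup>1 g\<close>. Far out, \<open>\<Delta>\<^sup>k\<^sup>+\<^sup>1 g\<close> is positive and tiny whereas \<open>\<Delta>\<^sup>k g\<close> is unbounded,
  so \<open>\<Delta>\<^sup>k g\<close> sweeps slowly through the circle; stop it in a small window just above 0, where
  it remains for a long time. Meanwhile \<open>\<Delta>\<^sup>k\<^sup>-\<^sup>1 g\<close> sweeps the circle in small positive
  steps and can be stopped in a (larger) window, and so on down to \<open>\<Delta> g\<close>, which is stopped
  slightly above \<open>1 / R\<close>. Then \<open>n\<^sup>c\<close> grows by slightly more than 1 modulo \<open>R\<close> at each step for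
  long enough to meet every residue class at the start of a run of \<open>H\<close> consecutive residues.
  A window of width \<open>w\<close> at level \<open>j\<close> needs width about \<open>w\<^sup>2\<close> at level \<open>j + 1\<close>; this doubling
  of exponents accounts for the factor \<open>2\<^sup>c\<close> in \<open>\<beta>\<close>.
\<close>

section \<open>Intervals modulo 1\<close>

text \<open>Encoded by an integer translate rather than by \<open>frac\<close>: an interval may then
  straddle an integer, and memberships add endpoint by endpoint without case splits.\<close>

definition in_mod1 :: "real \<Rightarrow> real \<Rightarrow> real \<Rightarrow> bool" where
  "in_mod1 l u x \<longleftrightarrow> (\<exists>z::int. l \<le> x - z \<and> x - z \<le> u)"

lemma in_mod1_mono: "in_mod1 l u x \<Longrightarrow> l' \<le> l \<Longrightarrow> u \<le> u' \<Longrightarrow> in_mod1 l' u' x"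
  unfolding in_mod1_def by (meson order_trans)

lemma in_mod1_add:
  assumes "in_mod1 l u x" "in_mod1 l' u' y"
  shows "in_mod1 (l + l') (u + u') (x + y)"
proof -
  obtain z z' :: int where "l \<le> x - z" "x - z \<le> u" "l' \<le> y - z'" "y - z' \<le> u'"
    using assms unfolding in_mod1_def by blast
  then show ?thesis unfolding in_mod1_def by (intro exI[of _ "z + z'"]) auto
qed

lemma in_mod1_add_int: "in_mod1 (l + of_int k) (u + of_int k) x \<Longrightarrow> in_mod1 l u x"
  unfolding in_mod1_def
proof (elim exE conjE)
  fix z :: int
  assume "l + k \<le> x - z" "x - z \<le> u + k"
  then show "\<exists>z::int. l \<le> x - z \<and> x - z \<le> u"
    by (intro exI[of _ "z + k"]) auto
qed

lemma in_mod1_telescope: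
  assumes "\<And>i. i < n \<Longrightarrow> in_mod1 l u (x (Suc i) - x i)"
  shows "in_mod1 (real n * l) (real n * u) (x n - x 0)"
  using assms
proof (induction n)
  case 0
  show ?case by (auto simp: in_mod1_def intro!: exI[of _ 0])
next
  case (Suc n)
  have "in_mod1 (real n * l + l) (real n * u + u) ((x n - x 0) + (x (Suc n) - x n))"
    using Suc by (intro in_mod1_add) auto
  then show ?case by (simp add: algebra_simps)
qed

section \<open>Slow sweeps around the circle\<close>

text \<open>Without the integer jumps \<open>z\<close>, the path is nondecreasing and rises by at
  least 1, so it reaches some integer translate of \<open>t\<close>. At the first passage it
  overshoots by at most one step, hence by at most \<open>v\<close>.\<close>

lemma sweep_hits:
  fixes x d :: "nat \<Rightarrow> real" and z :: "nat \<Rightarrow> int"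
  assumes step: "\<And>n. n < N \<Longrightarrow> x (Suc n) = x n + d n + z n"
    and d: "\<And>n. n < N \<Longrightarrow> 0 \<le> d n" "\<And>n. n < N \<Longrightarrow> d n \<le> v"
    and total: "1 \<le> (\<Sum>n<N. d n)" and "0 \<le> v"
  shows "\<exists>n\<le>N. in_mod1 t (t + v) (x n)"
proof -
  define b where "b n = x 0 + (\<Sum>i<n. d i)" for n
  have xb: "x n = b n + of_int (\<Sum>i<n. z i)" if "n \<le> N" for n
    using that by (induction n) (auto simp: b_def step)
  \<comment> \<open>The first integer translate of \<open>t\<close> not below \<open>x 0\<close>; it
    is less than \<open>x 0 + 1\<close>, hence within the total rise.\<close>
  define q where "q = t + \<lceil>x 0 - t\<rceil>"
  have q: "b 0 \<le> q" "q \<le> b N"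
    using total unfolding q_def b_def by (auto, linarith+)
  define n where "n = (LEAST n. q \<le> b n)"
  have n: "q \<le> b n" unfolding n_def by (rule LeastI[of "\<lambda>n. q \<le> b n"]) (rule q)
  have nN: "n \<le> N" unfolding n_def by (rule Least_le) (rule q)
  have "b n \<le> q + v"
  proof (cases n)
    case 0
    then show ?thesis using q \<open>0 \<le> v\<close> by auto
  next
    case (Suc k)
    then have "b k < q" using not_less_Least[of k "\<lambda>n. q \<le> b n"] by (auto simp: n_def)
    moreover have "b n = b k + d k" using Suc by (simp add: b_def)
    ultimately show ?thesis using d(2)[of k] Suc nN by auto
  qed
  with n xb[OF nN] have "in_mod1 t (t + v) (x n)"
    unfolding in_mod1_def q_def
    by (intro exI[of _ "(\<Sum>i<n. z i) + \<lceil>x 0 - t\<rceil>"]) auto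
  with nN show ?thesis by blast
qed

text \<open>Aim at \<open>t + w\<close>: the overshoot and the drift over the next \<open>L\<close>
  steps cost at most \<open>w / 2\<close> each. The window starts at \<open>t + w\<close> and not at
  \<open>t\<close>, so that for \<open>t = 0\<close> its values are bounded away from 0 and can
  drive the next sweep.\<close>

lemma sweep_stays:
  fixes x d :: "nat \<Rightarrow> real" and z :: "nat \<Rightarrow> int"
  assumes step: "\<And>n. n < N + L \<Longrightarrow> x (Suc n) = x n + d n + z n"
    and d: "\<And>n. n < N + L \<Longrightarrow> 0 \<le> d n" "\<And>n. n < N + L \<Longrightarrow> d n \<le> v"
    and total: "1 \<le> (\<Sum>n<N. d n)" and "0 \<le> v" "v \<le> w / 2" "real L * v \<le> w / 2"
  shows "\<exists>m\<le>N. \<forall>n\<le>L. in_mod1 (t + w) (t + 2 * w) (x (m + n))"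
proof -
  obtain m where m: "m \<le> N" "in_mod1 (t + w) (t + w + v) (x m)"
    using sweep_hits[of N x d z v "t + w"] assms by (metis trans_less_add1)
  have "in_mod1 (t + w) (t + 2 * w) (x (m + n))" if "n \<le> L" for n
  proof -
    have "in_mod1 (real n * 0) (real n * v) (x (m + n) - x (m + 0))"
    proof (rule in_mod1_telescope[of n 0 v "\<lambda>i. x (m + i)"])
      fix i assume "i < n"
      then have "m + i < N + L" using m that by auto
      from step[OF this] d[OF this] show "in_mod1 0 v (x (m + Suc i) - x (m + i))"
        unfolding in_mod1_def by (intro exI[of _ "z (m + i)"]) auto
    qed
    from in_mod1_add[OF m(2) this]
    have "in_mod1 (t + w) (t + w + v + real n * v) (x (m + n))" by simp
    moreover have "real n * v \<le> real L * v" using that \<open>0 \<le> v\<close> by (intro mult_right_mono) auto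
    moreover have "t + w + v + real n * v \<le> t + 2 * w" using assms(6,7) calculation by linarith
    ultimately show ?thesis using in_mod1_mono by blast
  qed
  with m show ?thesis by blast
qed

text \<open>The form for the descent, where increments are known only modulo 1 but have a uniform
  lower bound \<open>l\<close>; then \<open>N\<close> of them complete a full turn.\<close>

lemma sweep_stays_uniform:
  fixes x :: "nat \<Rightarrow> real"
  assumes step: "\<And>n. n < N + L \<Longrightarrow> in_mod1 l v (x (Suc n) - x n)"
    and "0 \<le> l" "1 \<le> real N * l" "0 \<le> v" "v \<le> w / 2" "real L * v \<le> w / 2"
  shows "\<exists>m\<le>N. \<forall>n\<le>L. in_mod1 (t + w) (t + 2 * w) (x (m + n))"
proof -
  obtain z :: "nat \<Rightarrow> int" where
    z: "\<And>n. n < N + L \<Longrightarrow> l \<le> x (Suc n) - x n - z n \<and> x (Suc n) - x n - z n \<le> v"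
    using step unfolding in_mod1_def by metis
  show ?thesis
  proof (rule sweep_stays[of N L x "\<lambda>n. x (Suc n) - x n - z n" z v])
    have "real N * l = (\<Sum>n<N. l)" by simp
    also have "\<dots> \<le> (\<Sum>n<N. x (Suc n) - x n - z n)" using z by (intro sum_mono) auto
    finally show "1 \<le> (\<Sum>n<N. x (Suc n) - x n - z n)" using assms(3) by linarith
    show "0 \<le> x (Suc n) - x n - z n" if "n < N + L" for n
      using z[OF that] assms(2) by linarith
  qed (use z assms in auto)
qed

section \<open>Forward differences and derivatives\<close>

text \<open>Generic in the argument type, so that the sequence on \<open>nat\<close> and the
  function on the reals share one operator.\<close>

primrec fwd_diff :: "nat \<Rightarrow> ('a::semiring_1 \<Rightarrow> real) \<Rightarrow> 'a \<Rightarrow> real" where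
  "fwd_diff 0 f x = f x"
| "fwd_diff (Suc j) f x = fwd_diff j f (x + 1) - fwd_diff j f x"

lemma fwd_diff_shift: "fwd_diff j (\<lambda>y. f (y + 1) - f y) x = fwd_diff (Suc j) f x"
  by (induction j arbitrary: x) simp_all

lemma fwd_diff_of_nat: "fwd_diff j (\<lambda>n::nat. f (of_nat n)) n = fwd_diff j f (of_nat n)"
  by (induction j arbitrary: n) (simp_all add: add.commute)

lemma fwd_diff_divide: "fwd_diff j (\<lambda>x. f x / r) x = fwd_diff j f x / r"
  by (induction j arbitrary: x) (simp_all add: diff_divide_distrib)

text \<open>Iterated mean value theorem: \<open>D i\<close> is the derivative of order
  \<open>i\<close>, and each difference is exchanged for one derivative at an intermediate
  point.\<close>

lemma fwd_diff_bounds: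
  fixes D :: "nat \<Rightarrow> real \<Rightarrow> real"
  assumes "\<And>i y. x \<le> y \<Longrightarrow> (D i has_real_derivative D (Suc i) y) (at y)"
    and "\<And>y. x \<le> y \<Longrightarrow> y \<le> x + real j \<Longrightarrow> A \<le> D j y \<and> D j y \<le> B"
  shows "A \<le> fwd_diff j (D 0) x \<and> fwd_diff j (D 0) x \<le> B"
  using assms
proof (induction j arbitrary: D)
  case 0
  then show ?case by simp
next
  case (Suc j)
  \<comment> \<open>The differenced family is again a chain of successive derivatives, so the
    induction hypothesis applies to it.\<close>
  define E where "E i y = D i (y + 1) - D i y" for i y
  have "A \<le> fwd_diff j (E 0) x \<and> fwd_diff j (E 0) x \<le> B"
  proof (rule Suc.IH)
    fix i y assume y: "x \<le> y"
    show "(E i has_real_derivative E (Suc i) y) (at y)"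
      unfolding E_def using y
      by (intro DERIV_diff Suc.prems DERIV_shift[THEN iffD1]) auto
  next
    fix y assume y: "x \<le> y" "y \<le> x + real j"
    obtain s where "y < s" "s < y + 1" "E j y = (y + 1 - y) * D (Suc j) s"
      using MVT2[of y "y + 1" "D j" "D (Suc j)"] Suc.prems(1) y unfolding E_def by force
    then show "A \<le> E j y \<and> E j y \<le> B" using Suc.prems(2)[of s] y by auto
  qed
  moreover have "fwd_diff j (E 0) x = fwd_diff (Suc j) (D 0) x"
    using fwd_diff_shift[of j "D 0" x] by (simp add: E_def[abs_def])
  ultimately show ?case by simp
qed

lemma fwd_diff_powr_bounds:
  fixes x c :: real
  assumes "0 < x"
    and "\<And>y. x \<le> y \<Longrightarrow> y \<le> x + real j \<Longrightarrow>
           A \<le> (\<Prod>i<j. c - real i) * y powr (c - real j) \<and> (\<Prod>i<j. c - real i) * y powr (c - real j) \<le> B"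
  shows "A \<le> fwd_diff j (\<lambda>y. y powr c) x \<and> fwd_diff j (\<lambda>y. y powr c) x \<le> B"
proof -
  define D where "D j y = (\<Prod>i<j. c - real i) * y powr (c - real j)" for j :: nat and y :: real
  have "A \<le> fwd_diff j (D 0) x \<and> fwd_diff j (D 0) x \<le> B"
  proof (rule fwd_diff_bounds)
    fix i y assume "x \<le> y"
    then show "(D i has_real_derivative D (Suc i) y) (at y)"
      unfolding D_def using assms(1)
      by (auto intro!: derivative_eq_intros simp: algebra_simps)
  qed (use assms(2) in \<open>auto simp: D_def\<close>)
  then show ?thesis by (simp add: D_def[abs_def])
qed

section \<open>Nested windows for the differences\<close>

text \<open>At level \<open>j\<close> the window has width \<open>R\<close> to the power \<open>- level_exp j\<close> and is kept for
  \<open>R\<close> to the power \<open>level_exp j + 1\<close> steps.\<close>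

definition level_exp :: "nat \<Rightarrow> nat" where
  "level_exp j = 3 * 2 ^ j - 2"

lemma level_exp_Suc: "level_exp (Suc j) = 2 * level_exp j + 2"
proof -
  have "(1::nat) \<le> 2 ^ j" by simp
  then have "2 \<le> 3 * (2::nat) ^ j" by linarith
  then show ?thesis unfolding level_exp_def by simp
qed

text \<open>The conditions on \<open>v\<close> and \<open>L * v\<close> for a sweep at level
  \<open>j\<close> driven by level \<open>Suc j\<close>. In the recurrence
  \<open>2 * level_exp j + 2\<close>, the doubled exponent and one factor \<open>R\<close> pay for
  the length of the stay; the other factor \<open>R\<close> absorbs the constant 4.\<close>

lemma window_shrink:
  assumes "4 \<le> (R::nat)"
  shows "2 * (1 / real R ^ level_exp (Suc j)) \<le> 1 / real R ^ level_exp j / 2"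
    and "real (R ^ (level_exp j + 1)) * (2 * (1 / real R ^ level_exp (Suc j)))
           \<le> 1 / real R ^ level_exp j / 2"
proof -
  define a where "a = level_exp j"
  have R: "4 \<le> real R" using assms by simp
  have Ra: "1 \<le> real R ^ a" using R by simp
  have "level_exp (Suc j) = a + a + 1 + 1" by (simp add: level_exp_Suc a_def)
  then have *: "real R ^ level_exp (Suc j) = real R ^ a * real R ^ a * real R * real R"
    by (simp add: power_add)
  have "4 * 1 \<le> (real R * real R ^ a) * real R"
  proof -
    have "4 * 1 \<le> (real R * real R ^ a)" using R Ra by (intro mult_mono) auto
    then have "(4 * 1) * 1 \<le> (real R * real R ^ a) * real R" using R by (intro mult_mono) auto
    then show ?thesis by simp
  qed
  then show "2 * (1 / real R ^ level_exp (Suc j)) \<le> 1 / real R ^ level_exp j / 2"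
    unfolding * a_def[symmetric] using R Ra by (simp add: field_simps)
  show "real (R ^ (level_exp j + 1)) * (2 * (1 / real R ^ level_exp (Suc j)))
           \<le> 1 / real R ^ level_exp j / 2"
    unfolding * a_def[symmetric] using R Ra by (simp add: field_simps)
qed

text \<open>Only the first difference has a nonzero target: \<open>g\<close> should advance by about
  \<open>1 / R\<close>, that is, the power by about 1. Higher differences only need to be small and
  positive.\<close>

definition level_target :: "nat \<Rightarrow> nat \<Rightarrow> real" where
  "level_target R j = (if j = 1 then 1 / real R else 0)"

definition level_ok :: "nat \<Rightarrow> (nat \<Rightarrow> real) \<Rightarrow> nat \<Rightarrow> nat \<Rightarrow> bool" where
  "level_ok R g j m \<longleftrightarrow> (\<forall>n\<le>R ^ (level_exp j + 1).
     in_mod1 (level_target R j + 1 / real R ^ level_exp j)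
             (level_target R j + 2 * (1 / real R ^ level_exp j)) (fwd_diff j g (m + n)))"

text \<open>\<open>N\<close> steps of size at least \<open>1 / N\<close> make a full turn, and the
  good stretch of level \<open>Suc j\<close> has room for \<open>N\<close> steps plus the stay
  \<open>L\<close>. The new stretch lies inside the old one, so repeated descent does not lengthen
  the search. With \<open>1 \<le> j\<close>, the driving level has target 0.\<close>

lemma level_ok_descend:
  assumes "4 \<le> R" "1 \<le> j" "level_ok R g (Suc j) m"
  shows "\<exists>m'\<ge>m. m' + R ^ (level_exp j + 1) \<le> m + R ^ (level_exp (Suc j) + 1) \<and> level_ok R g j m'"
proof -
  define N where "N = R ^ level_exp (Suc j)"
  define L where "L = R ^ (level_exp j + 1)"
  have "L \<le> N" unfolding L_def N_def using assms(1)
    by (intro power_increasing) (auto simp: level_exp_Suc)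
  then have "N + L \<le> 4 * N" by simp
  also have "\<dots> \<le> R * N" using assms(1) by simp
  finally have NL: "N + L \<le> R ^ (level_exp (Suc j) + 1)" by (simp add: N_def)
  have "\<exists>m0\<le>N. \<forall>n\<le>L. in_mod1 (level_target R j + 1 / real R ^ level_exp j)
      (level_target R j + 2 * (1 / real R ^ level_exp j)) (fwd_diff j g (m + (m0 + n)))"
  proof (rule sweep_stays_uniform[of N L "1 / real R ^ level_exp (Suc j)"
        "2 * (1 / real R ^ level_exp (Suc j))" "\<lambda>n. fwd_diff j g (m + n)"])
    fix n assume "n < N + L"
    then have "n \<le> R ^ (level_exp (Suc j) + 1)" using NL by linarith
    with assms(2,3)
    show "in_mod1 (1 / real R ^ level_exp (Suc j)) (2 * (1 / real R ^ level_exp (Suc j)))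
        (fwd_diff j g (m + Suc n) - fwd_diff j g (m + n))"
      by (simp add: level_ok_def level_target_def)
  next
    show "1 \<le> real N * (1 / real R ^ level_exp (Suc j))"
      using assms(1) by (simp add: N_def)
  qed (use window_shrink[OF assms(1)] in \<open>auto simp: L_def\<close>)
  then obtain m0 where m0: "m0 \<le> N" "level_ok R g j (m + m0)"
    unfolding level_ok_def L_def by (auto simp: add.assoc)
  then show ?thesis using NL by (intro exI[of _ "m + m0"]) (auto simp: L_def)
qed

lemma level_ok_descend_to_1:
  assumes "4 \<le> R" "1 \<le> k" "level_ok R g k m"
  shows "\<exists>m'\<ge>m. m' + R ^ 5 \<le> m + R ^ (level_exp k + 1) \<and> level_ok R g 1 m'"
  using assms(2,3)
proof (induction k arbitrary: m rule: dec_induct)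
  case base
  then show ?case by (intro exI[of _ m]) (auto simp: level_exp_def)
next
  case (step k)
  obtain m1 where m1: "m \<le> m1" "m1 + R ^ (level_exp k + 1) \<le> m + R ^ (level_exp (Suc k) + 1)"
      "level_ok R g k m1"
    using level_ok_descend[OF assms(1) _ step.prems] step.hyps by auto
  from step.IH[OF m1(3)] m1 show ?case by (meson order_trans add_le_mono1 le_trans)
qed

section \<open>Residue classes from the first difference\<close>

text \<open>Steps of length \<open>R\<close> remove the drift \<open>1 / R\<close> of the first difference, so that only the
  slow part of the motion is left and every residue class is met.\<close>

lemma level_ok_1_residues:
  fixes g :: "nat \<Rightarrow> real" and r :: int
  assumes R: "4 \<le> R" and "H \<le> R" and ok: "level_ok R g 1 m"
  shows "\<exists>M\<ge>m. M \<le> m + R ^ 5 \<and>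
           (\<forall>h\<le>H. \<exists>z::int. (r + h) / real R \<le> g (M + h) - z \<and> g (M + h) - z < (r + h + 1) / real R)"
proof -
  have R4: "4 \<le> real R" using R by simp
  \<comment> \<open>Room in the stretch of \<open>R ^ 5\<close> steps: long steps start at offsets
    up to \<open>R ^ 4\<close>, and at most \<open>R\<close> single steps follow.\<close>
  have "(R ^ 4) * 4 \<le> R ^ 4 * R" using R by simp
  then have R5: "R ^ 4 * 4 \<le> R ^ 5" by (simp add: numeral_eq_Suc)
  have RR4: "R \<le> R ^ 4" using R by (simp add: self_le_power)
  have step: "in_mod1 (1 / R + 1 / R ^ 4) (1 / R + 2 / R ^ 4) (g (m + Suc n) - g (m + n))"
    if "n \<le> R ^ 5" for n
    using ok that unfolding level_ok_def level_target_def
    by (simp add: level_exp_def)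
  have long: "in_mod1 (1 / R ^ 3) (2 / R ^ 3) (g (m + R * Suc i) - g (m + R * i))"
    if "i \<le> R ^ 3" for i
  proof -
    have "R * i \<le> R * R ^ 3" using that by simp
    then have Ri: "R * i \<le> R ^ 4" by (simp add: numeral_eq_Suc)
    have "in_mod1 (R * (1 / R + 1 / R ^ 4)) (R * (1 / R + 2 / R ^ 4))
            (g (m + (R * i + R)) - g (m + (R * i + 0)))"
    proof (rule in_mod1_telescope[of R _ _ "\<lambda>n. g (m + (R * i + n))"])
      fix n assume "n < R"
      then have "R * i + n \<le> R ^ 5" using Ri RR4 R5 by linarith
      from step[OF this] show "in_mod1 (1 / R + 1 / R ^ 4) (1 / R + 2 / R ^ 4)
          (g (m + (R * i + Suc n)) - g (m + (R * i + n)))" by simp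
    qed
    moreover have "real R * (1 / real R + a / real R ^ 4) = a / real R ^ 3 + 1" for a
      using R4 by (simp add: distrib_left numeral_eq_Suc)
    ultimately have "in_mod1 (1 / R ^ 3 + of_int 1) (2 / R ^ 3 + of_int 1)
        (g (m + R * Suc i) - g (m + R * i))"
      by (simp add: add_ac)
    then show ?thesis by (rule in_mod1_add_int)
  qed
  obtain z :: "nat \<Rightarrow> int" where
    z: "\<And>i. i \<le> R ^ 3 \<Longrightarrow> 1 / R ^ 3 \<le> g (m + R * Suc i) - g (m + R * i) - z i
          \<and> g (m + R * Suc i) - g (m + R * i) - z i \<le> 2 / R ^ 3"
    using long unfolding in_mod1_def by metis
  \<comment> \<open>\<open>R ^ 3\<close> long steps, each at least \<open>1 / R ^ 3\<close>,
    complete a turn and so pass \<open>r / R\<close>.\<close>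
  have "\<exists>i\<le>R ^ 3. in_mod1 (r / R) (r / R + 2 / R ^ 3) (g (m + R * i))"
  proof (rule sweep_hits[of "R ^ 3" "\<lambda>i. g (m + R * i)"
        "\<lambda>i. g (m + R * Suc i) - g (m + R * i) - z i" z])
    have "1 = (\<Sum>i<R ^ 3. 1 / real R ^ 3)" using R4 by simp
    also have "\<dots> \<le> (\<Sum>i<R ^ 3. g (m + R * Suc i) - g (m + R * i) - z i)"
      using z by (intro sum_mono) auto
    finally show "1 \<le> (\<Sum>i<R ^ 3. g (m + R * Suc i) - g (m + R * i) - z i)" .
    show "0 \<le> g (m + R * Suc n) - g (m + R * n) - z n" if "n < R ^ 3" for n
      using z[of n] that by (meson less_imp_le order_trans zero_le_divide_1_iff of_nat_0_le_iff)
  qed (use z in \<open>auto\<close>)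
  then obtain i where i: "i \<le> R ^ 3" "in_mod1 (r / R) (r / R + 2 / R ^ 3) (g (m + R * i))"
    by blast
  define M where "M = m + R * i"
  have "R * i \<le> R * R ^ 3" using i by simp
  then have Ri: "R * i \<le> R ^ 4" by (simp add: numeral_eq_Suc)
  have "\<exists>z::int. (r + h) / real R \<le> g (M + h) - z \<and> g (M + h) - z < (r + h + 1) / real R"
    if h: "h \<le> H" for h
  proof -
    have "in_mod1 (h * (1 / R + 1 / R ^ 4)) (h * (1 / R + 2 / R ^ 4)) (g (M + h) - g (M + 0))"
    proof (rule in_mod1_telescope[of h _ _ "\<lambda>n. g (M + n)"])
      fix n assume "n < h"
      then have "R * i + n \<le> R ^ 5" using Ri RR4 R5 h assms(2) by linarith
      from step[OF this] show "in_mod1 (1 / R + 1 / R ^ 4) (1 / R + 2 / R ^ 4)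
          (g (M + Suc n) - g (M + n))" by (simp add: M_def add.assoc)
    qed
    from in_mod1_add[OF i(2) this]
    obtain z :: int where z: "r / R + h * (1 / R + 1 / R ^ 4) \<le> g (M + h) - z"
        "g (M + h) - z \<le> r / R + 2 / R ^ 3 + h * (1 / R + 2 / R ^ 4)"
      unfolding in_mod1_def M_def by auto
    have "(r + h) / R \<le> r / R + h * (1 / R + 1 / R ^ 4)"
      using R4 by (simp add: add_divide_distrib distrib_left)
    \<comment> \<open>The excess over \<open>(r + h) / R\<close>, from the initial overshoot and
      \<open>h\<close> single steps, must stay below \<open>1 / R\<close>, the length of the arc
      belonging to one residue.\<close>
    moreover have "2 / R ^ 3 + h * (2 / R ^ 4) < 1 / real R"
    proof -
      have "h * (2 / R ^ 4) \<le> real R * (2 / R ^ 4)"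
        using h assms(2) by (intro mult_right_mono) auto
      also have "\<dots> = 2 / R ^ 3" using R4 by (simp add: field_simps numeral_eq_Suc)
      finally have "2 / R ^ 3 + h * (2 / R ^ 4) \<le> 4 / real R ^ 3" by simp
      also have "\<dots> < 1 / real R"
      proof -
        have "4 * 1 < real R * real R" using R4 by (intro mult_le_less_imp_less) auto
        then show ?thesis using R4 by (simp add: field_simps numeral_eq_Suc)
      qed
      finally show ?thesis .
    qed
    moreover have "r / R + 2 / R ^ 3 + h * (1 / R + 2 / R ^ 4)
        = (r + h) / R + (2 / R ^ 3 + h * (2 / R ^ 4))"
      by (simp add: add_divide_distrib distrib_left)
    moreover have "(r + h + 1) / real R = (r + h) / R + 1 / real R"
      by (simp add: add_divide_distrib)
    ultimately show ?thesis using z by (intro exI[of _ z]) linarith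
  qed
  moreover have "M \<le> m + R ^ 5" using Ri R5 unfolding M_def by linarith
  ultimately show ?thesis by (intro exI[of _ M]) (auto simp: M_def)
qed

section \<open>The top level for the power function\<close>

text \<open>Since \<open>c < k + 1\<close>, the bound \<open>slow\<close> at \<open>X\<close>
  persists beyond \<open>X\<close>; since \<open>k < c\<close>, the difference of order
  \<open>k\<close> grows, and \<open>far\<close> makes it rise by at least 1 between
  \<open>X\<close> and \<open>X + N\<close>.\<close>

lemma level_ok_start:
  fixes c :: real and k R X N :: nat
  defines "P \<equiv> \<lambda>j::nat. \<Prod>i<j. c - real i"
  assumes "4 \<le> R" "real k < c" "c < real k + 1" "0 < X"
    and slow: "P (Suc k) * real X powr (c - real (Suc k)) / R \<le> 2 * (1 / real R ^ level_exp (Suc k))"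
    and far: "real R \<le> P k * (real (X + N) powr (c - real k) - real (X + k) powr (c - real k))"
  shows "\<exists>m\<ge>X. m \<le> X + N \<and> level_ok R (\<lambda>n. real n powr c / R) k m"
proof -
  define g where "g n = real n powr c / R" for n :: nat
  have P: "0 < P j" if "j \<le> Suc k" for j
    unfolding P_def using assms(3) that by (intro prod_pos) auto
  have g: "fwd_diff j g n = fwd_diff j (\<lambda>y. y powr c) (real n) / R" for j n
    using fwd_diff_of_nat[of j "\<lambda>y. y powr c / R" n] fwd_diff_divide[of j "\<lambda>y. y powr c" R]
    by (simp add: g_def[abs_def])
  \<comment> \<open>The exponent \<open>c - k\<close> is positive, so the extremes of the derivative
    on the interval are at its ends; hence the \<open>X + k\<close> in \<open>far\<close>.\<close>
  have lo: "P k * real n powr (c - k) / R \<le> fwd_diff k g n"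
    and hi: "fwd_diff k g n \<le> P k * real (n + k) powr (c - k) / R" if "0 < n" for n
  proof -
    have "P k * real n powr (c - k) \<le> fwd_diff k (\<lambda>y. y powr c) (real n) \<and>
        fwd_diff k (\<lambda>y. y powr c) (real n) \<le> P k * real (n + k) powr (c - k)"
      unfolding P_def
      by (rule fwd_diff_powr_bounds)
        (use that P[of k, unfolded P_def] assms(3) in \<open>auto intro!: mult_left_mono powr_mono2\<close>)
    then show "P k * real n powr (c - k) / R \<le> fwd_diff k g n"
      "fwd_diff k g n \<le> P k * real (n + k) powr (c - k) / R"
      by (auto simp: g intro!: divide_right_mono)
  qed
  have top: "0 \<le> fwd_diff (Suc k) g n \<and> fwd_diff (Suc k) g n \<le> 2 * (1 / real R ^ level_exp (Suc k))"
    if "X \<le> n" for n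
  proof -
    have "0 \<le> fwd_diff (Suc k) (\<lambda>y. y powr c) (real n) \<and>
        fwd_diff (Suc k) (\<lambda>y. y powr c) (real n) \<le> P (Suc k) * real X powr (c - Suc k)"
      unfolding P_def
    proof (rule fwd_diff_powr_bounds)
      fix y assume "real n \<le> y"
      then show "0 \<le> (\<Prod>i<Suc k. c - real i) * y powr (c - Suc k) \<and>
          (\<Prod>i<Suc k. c - real i) * y powr (c - Suc k)
            \<le> (\<Prod>i<Suc k. c - real i) * real X powr (c - Suc k)"
        using that \<open>0 < X\<close> P[of "Suc k", unfolded P_def] assms(4)
        by (auto intro!: mult_left_mono powr_mono2' simp del: prod.lessThan_Suc)
    qed (use that \<open>0 < X\<close> in auto)
    then have "0 \<le> fwd_diff (Suc k) g n"
      "fwd_diff (Suc k) g n \<le> P (Suc k) * real X powr (c - Suc k) / R"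
      unfolding g by (auto intro!: divide_right_mono simp del: fwd_diff.simps)
    then show ?thesis using slow by linarith
  qed
  \<comment> \<open>The steps are true differences, so the integer jumps are 0. As they tend to 0,
    the full turn comes from telescoping and not from a uniform lower bound.\<close>
  have "\<exists>m0\<le>N. \<forall>n\<le>R ^ (level_exp k + 1). in_mod1 (level_target R k + 1 / real R ^ level_exp k)
      (level_target R k + 2 * (1 / real R ^ level_exp k)) (fwd_diff k g (X + (m0 + n)))"
  proof (rule sweep_stays[of N "R ^ (level_exp k + 1)" "\<lambda>n. fwd_diff k g (X + n)"
        "\<lambda>n. fwd_diff (Suc k) g (X + n)" "\<lambda>_. 0" "2 * (1 / real R ^ level_exp (Suc k))"])
    have "1 \<le> P k * (real (X + N) powr (c - k) - real (X + k) powr (c - k)) / R"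
      using far assms(2) by simp
    also have "\<dots> \<le> fwd_diff k g (X + N) - fwd_diff k g (X + 0)"
      using lo[of "X + N"] hi[of X] \<open>0 < X\<close> by (simp add: right_diff_distrib diff_divide_distrib)
    also have "\<dots> = (\<Sum>n<N. fwd_diff (Suc k) g (X + n))"
      using sum_lessThan_telescope[of "\<lambda>n. fwd_diff k g (X + n)" N] by simp
    finally show "1 \<le> (\<Sum>n<N. fwd_diff (Suc k) g (X + n))" .
  qed (use top window_shrink[OF assms(2)] in \<open>auto simp del: of_nat_power\<close>)
  then obtain m0 where "m0 \<le> N" "level_ok R g k (X + m0)"
    unfolding level_ok_def by (auto simp: add.assoc)
  then show ?thesis unfolding g_def[abs_def] by (intro exI[of _ "X + m0"]) auto
qed

section \<open>Choice of parameters and the size of the solution\<close>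

lemma residues_of_powr:
  fixes c e :: real and k R H :: nat and r :: int
  assumes "1 \<le> k" "real k < c" "c < real k + 1"
    and e: "0 < e" "e \<le> c - k" "e \<le> real k + 1 - c"
    and R: "4 \<le> R" "H \<le> R" "k + 1 \<le> R" "(\<Prod>i<Suc k. c - real i) \<le> R"
  shows "\<exists>M>0. real M \<le> real R powr (18 * 2 ^ k / e) \<and>
           (\<forall>h\<le>H. [\<lfloor>real (M + h) powr c\<rfloor> = r + int h] (mod int R))"
proof -
  \<comment> \<open>Chosen so that \<open>a * e\<close> is at least
    \<open>level_exp (Suc k)\<close>: then \<open>Y powr (c - k - 1)\<close> is at most
    \<open>1 / R ^ level_exp (Suc k)\<close>, and \<open>Y powr (c - k)\<close> is at least
    \<open>R\<close>.\<close>
  define a where "a = 6 * 2 ^ k / e"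
  define Y where "Y = real R powr a"
  define X where "X = nat \<lceil>Y\<rceil>"
  \<comment> \<open>With \<open>u = Y powr (c - k)\<close>, squaring \<open>Y\<close> gives growth
    of at least \<open>u * u - 2 * u\<close>, which is at least \<open>R\<close>. The search then
    ends below \<open>Y ^ 3\<close>, whence the exponent \<open>3 * a\<close>.\<close>
  define N where "N = nat \<lceil>Y\<^sup>2\<rceil>"
  have R4: "4 \<le> real R" using R(1) by simp
  have e1: "e \<le> 1" using e(2,3) by linarith
  have ae: "a * e = 6 * 2 ^ k" using e(1) by (simp add: a_def)
  have a_ge: "6 * 2 ^ k \<le> a" unfolding a_def using e1 e(1) by (simp add: field_simps)
  have two: "(1::real) \<le> 2 ^ k" by simp
  have a0: "0 \<le> a" using a_ge two by linarith
  have RY: "real R \<le> Y"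
    using powr_mono[of 1 a "real R"] a_ge two R4 unfolding Y_def by simp
  have Y4: "4 \<le> Y" using RY R4 by simp
  have X: "Y \<le> real X" "real X \<le> Y + 1" "0 < X" unfolding X_def using Y4 by linarith+
  have "0 \<le> Y\<^sup>2" by simp
  then have N: "Y\<^sup>2 \<le> real N" "real N \<le> Y\<^sup>2 + 1" unfolding N_def by linarith+
  have Pk: "1 \<le> (\<Prod>i<k. c - real i)"
    using assms(2) by (intro prod_ge_1) auto

  have "\<exists>m\<ge>X. m \<le> X + N \<and> level_ok R (\<lambda>n. real n powr c / R) k m"
  proof (rule level_ok_start)
    have "real X powr (c - real (Suc k)) \<le> Y powr (c - real (Suc k))"
      using X Y4 assms(3) by (intro powr_mono2') auto
    also have "\<dots> = R powr (a * (c - real (Suc k)))" by (simp add: Y_def powr_powr)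
    also have "\<dots> \<le> R powr (- (real (level_exp (Suc k))))"
    proof (rule powr_mono)
      have "a * e \<le> a * (real (Suc k) - c)" using e(3) a0 by (intro mult_left_mono) auto
      moreover have "real (level_exp (Suc k)) \<le> 6 * 2 ^ k"
      proof -
        have "level_exp (Suc k) \<le> 6 * 2 ^ k" by (simp add: level_exp_def)
        then have "real (level_exp (Suc k)) \<le> real (6 * 2 ^ k)" by (rule of_nat_mono)
        then show ?thesis by simp
      qed
      ultimately show "a * (c - real (Suc k)) \<le> - real (level_exp (Suc k))"
        using ae by (simp add: algebra_simps)
    qed (use R4 in auto)
    also have "\<dots> = 1 / real R ^ level_exp (Suc k)"
      using R4 by (simp add: powr_minus powr_realpow divide_inverse)
    finally have *: "real X powr (c - real (Suc k)) \<le> 1 / real R ^ level_exp (Suc k)" .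
    have "(\<Prod>i<Suc k. c - real i) * real X powr (c - real (Suc k)) / R
        \<le> R * (1 / real R ^ level_exp (Suc k)) / R"
      using * R(4) by (intro divide_right_mono mult_mono) auto
    also have "\<dots> \<le> 2 * (1 / real R ^ level_exp (Suc k))" using R4 by (simp add: divide_right_mono)
    finally show "(\<Prod>i<Suc k. c - real i) * real X powr (c - real (Suc k)) / R
        \<le> 2 * (1 / real R ^ level_exp (Suc k))" .
  next
    define u where "u = Y powr (c - k)"
    have "1 \<le> a * (c - k)"
    proof -
      have "a * e \<le> a * (c - k)" using e(2) a0 by (intro mult_left_mono) auto
      then show ?thesis using ae two by linarith
    qed
    then have "real R powr 1 \<le> real R powr (a * (c - k))" using R4 by (intro powr_mono) auto
    then have u: "real R \<le> u" by (simp add: u_def Y_def powr_powr)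
    have "u * u = (Y\<^sup>2) powr (c - k)"
      using Y4 by (simp add: u_def power2_eq_square powr_mult)
    also have "\<dots> \<le> real (X + N) powr (c - k)"
      using N assms(2) Y4 by (intro powr_mono2) auto
    finally have big: "u * u \<le> real (X + N) powr (c - k)" .
    have "real (X + k) \<le> 2 * Y" using X(2) R(3) RY by linarith
    then have "real (X + k) powr (c - k) \<le> (2 * Y) powr (c - k)"
      using assms(2) by (intro powr_mono2) auto
    also have "\<dots> = 2 powr (c - k) * u" using Y4 by (simp add: powr_mult u_def)
    also have "\<dots> \<le> 2 * u"
      using powr_mono[of "c - k" 1 2] assms(3) u R4 by (intro mult_right_mono) auto
    finally have small: "real (X + k) powr (c - k) \<le> 2 * u" .
    have "1 * real R \<le> (u - 2) * u" using u R4 by (intro mult_mono) auto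
    then have "real R \<le> real (X + N) powr (c - k) - real (X + k) powr (c - k)"
      using big small by (simp add: algebra_simps)
    moreover from this have "1 * \<dots> \<le> (\<Prod>i<k. c - real i) * \<dots>"
      using Pk R4 by (intro mult_right_mono) auto
    ultimately show "real R \<le> (\<Prod>i<k. c - real i) *
        (real (X + N) powr (c - k) - real (X + k) powr (c - k))"
      unfolding mult_1 by (rule order_trans)
  qed (use assms X in auto)
  then obtain m where m: "X \<le> m" "m \<le> X + N" "level_ok R (\<lambda>n. real n powr c / R) k m"
    by blast
  obtain m' where m': "m \<le> m'" "m' + R ^ 5 \<le> m + R ^ (level_exp k + 1)"
      "level_ok R (\<lambda>n. real n powr c / R) 1 m'"
    using level_ok_descend_to_1[OF R(1) assms(1) m(3)] by blast
  obtain M where M: "m' \<le> M" "M \<le> m' + R ^ 5"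
    and res: "\<And>h. h \<le> H \<Longrightarrow> \<exists>z::int. (r + h) / real R \<le> real (M + h) powr c / R - z \<and>
        real (M + h) powr c / R - z < (r + h + 1) / real R"
    using level_ok_1_residues[OF R(1,2) m'(3), of r] by blast

  have "real (R ^ (level_exp k + 1)) = R powr (real (level_exp k + 1))"
    using R4 by (simp only: powr_realpow of_nat_power)
  also have "\<dots> \<le> Y" unfolding Y_def
  proof (rule powr_mono)
    have "level_exp k + 1 \<le> 3 * 2 ^ k + 1" by (simp add: level_exp_def)
    also have "\<dots> \<le> 3 * 2 ^ k + 3 * 2 ^ k" using one_le_power[of "2::nat" k] by linarith
    finally have "level_exp k + 1 \<le> 6 * 2 ^ k" by simp
    then have "real (level_exp k + 1) \<le> real (6 * 2 ^ k)" by (rule of_nat_mono)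
    then show "real (level_exp k + 1) \<le> a" using a_ge by simp
  qed (use R4 in auto)
  finally have L: "real (R ^ (level_exp k + 1)) \<le> Y" .
  have "M \<le> X + N + R ^ (level_exp k + 1)" using M(2) m'(2) m(2) by linarith
  then have "real M \<le> real X + real N + real (R ^ (level_exp k + 1))"
    by (metis of_nat_add of_nat_mono)
  also have "\<dots> \<le> Y\<^sup>2 + 2 * Y + 2" using L X(2) N(2) by linarith
  also have "\<dots> \<le> Y ^ 3"
  proof -
    have "4 * Y \<le> Y * Y" using Y4 by (intro mult_right_mono) auto
    moreover have "4 * (Y * Y) \<le> Y * (Y * Y)" using Y4 by (intro mult_right_mono) auto
    ultimately show ?thesis using Y4
      unfolding power2_eq_square power3_eq_cube mult.assoc by linarith
  qed
  also have "\<dots> = Y powr 3" using Y4 by (simp add: powr_numeral)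
  also have "\<dots> = R powr (18 * 2 ^ k / e)" by (simp add: Y_def powr_powr a_def)
  finally have bound: "real M \<le> R powr (18 * 2 ^ k / e)" .

  have "[\<lfloor>real (M + h) powr c\<rfloor> = r + int h] (mod int R)" if h: "h \<le> H" for h
  proof -
    obtain z :: int where "(r + h) / real R \<le> real (M + h) powr c / R - z"
        "real (M + h) powr c / R - z < (r + h + 1) / real R"
      using res[OF h] by blast
    then have "(r + h + R * z) / R \<le> real (M + h) powr c / R"
      "real (M + h) powr c / R < (r + h + R * z + 1) / R"
      using R4 by (simp_all add: add_divide_distrib)
    then have "real_of_int (r + h + int R * z) \<le> real (M + h) powr c"
      "real (M + h) powr c < real_of_int (r + h + int R * z) + 1"
      using R4 by (simp_all add: divide_le_cancel divide_less_cancel)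
    then have "\<lfloor>real (M + h) powr c\<rfloor> = r + h + int R * z" by (intro floor_unique)
    then show ?thesis by (simp add: cong_def)
  qed
  moreover have "0 < M" using M(1) m'(1) m(1) X(3) by linarith
  ultimately show ?thesis using bound by blast
qed

section \<open>The exponent \<open>\<beta>\<close> and the threshold for \<open>R\<close>\<close>

theorem theorem3:
  fixes c \<beta> :: real and H :: int
  assumes "c > 1" and "c \<notin> \<int>"
    and "\<beta> = 2 powr (c + 2) * (c + 2)\<^sup>2 / dist_nearest_int c"
    and "H > 0"
  shows "\<exists>R0::int. \<forall>R\<ge>R0. \<forall>r::int. \<exists>m::int. m > 0 \<and> real_of_int m \<le> real_of_int R powr \<beta> \<and>
           (\<forall>h\<in>{1..H}. [\<lfloor>real_of_int (m + h) powr c\<rfloor> = r + h] (mod R))"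
proof -
  define k where "k = nat \<lfloor>c\<rfloor>"
  define e where "e = dist_nearest_int c"
  have k: "real k = of_int \<lfloor>c\<rfloor>" "1 \<le> k" unfolding k_def using assms(1) by linarith+
  have fr: "frac c = c - k" by (simp add: frac_def k)
  have "0 < frac c" using assms(2) frac_gt_0_iff by blast
  then have kc: "real k < c" "c < real k + 1" using fr frac_lt_1[of c] by linarith+
  have e: "0 < e" "e \<le> c - k" "e \<le> real k + 1 - c"
    using kc unfolding e_def dist_nearest_int_def fr by auto
  have \<beta>: "18 * 2 ^ k / e \<le> \<beta>"
  proof -
    have "(2::real) ^ k * 4 = 2 powr (real k + 2)" by (simp add: powr_add powr_realpow)
    also have "\<dots> \<le> 2 powr (c + 2)" using kc by (intro powr_mono) auto
    \<comment> \<open>The factor \<open>3\<^sup>2\<close> comes from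
      \<open>c + 2 > 3\<close>.\<close>
    finally have "2 ^ k * 4 * 3\<^sup>2 \<le> 2 powr (c + 2) * (c + 2)\<^sup>2"
      using assms(1) by (intro mult_mono power_mono) auto
    then have "18 * 2 ^ k \<le> 2 powr (c + 2) * (c + 2)\<^sup>2"
      using zero_le_power[of "2::real" k] by (simp del: zero_le_power)
    then show ?thesis
      unfolding assms(3) e_def[symmetric] using e(1) by (intro divide_right_mono) auto
  qed
  define R0 where "R0 = max (max 4 H) (max (int k + 1) \<lceil>\<Prod>i<Suc k. c - real i\<rceil>)"
  show ?thesis
  proof (rule exI[of _ R0], intro allI impI)
    fix R r :: int assume "R0 \<le> R"
    then have R: "4 \<le> R" "H \<le> R" "int k + 1 \<le> R" "\<lceil>\<Prod>i<Suc k. c - real i\<rceil> \<le> R"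
      by (auto simp: R0_def)
    have nR: "int (nat R) = R" "real (nat R) = of_int R" using R(1) by auto
    have "\<exists>M>0. real M \<le> real (nat R) powr (18 * 2 ^ k / e) \<and>
        (\<forall>h\<le>nat H. [\<lfloor>real (M + h) powr c\<rfloor> = r + int h] (mod int (nat R)))"
    proof (rule residues_of_powr[OF k(2) kc e])
      show "(\<Prod>i<Suc k. c - real i) \<le> real (nat R)" using R(4) nR(2) by linarith
    qed (use R in auto)
    then obtain M where M: "0 < M" "real M \<le> of_int R powr (18 * 2 ^ k / e)"
      and res: "\<And>h. h \<le> nat H \<Longrightarrow> [\<lfloor>real (M + h) powr c\<rfloor> = r + int h] (mod R)"
      unfolding nR by blast
    show "\<exists>m::int. m > 0 \<and> real_of_int m \<le> real_of_int R powr \<beta> \<and>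
           (\<forall>h\<in>{1..H}. [\<lfloor>real_of_int (m + h) powr c\<rfloor> = r + h] (mod R))"
    proof (intro exI[of _ "int M"] conjI ballI)
      show "0 < int M" using M(1) by simp
      have "of_int R powr (18 * 2 ^ k / e) \<le> real_of_int R powr \<beta>"
        using \<beta> R(1) by (intro powr_mono) auto
      then show "real_of_int (int M) \<le> real_of_int R powr \<beta>" using M(2) by simp
      fix h assume "h \<in> {1..H}"
      then show "[\<lfloor>real_of_int (int M + h) powr c\<rfloor> = r + h] (mod R)"
        using res[of "nat h"] by (simp add: nat_mono)
    qed
  qed
qed

end
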